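(* Let $A$ be a Frobenius algebra over a field $\Bbbk$, and let $\mathfrak{Jac}(A)\in H^1(\mathrm{Aut}(A),A^\times)$ be its Nakayama Jacobian class. The algebra $A$ is symmetric if and only if the restriction of the class $\mathfrak{Jac}(A)$ from $H^1(\mathrm{Aut}(A),A^\times)$ to $H^1(\mathrm{Inn}(A),A^\times)$ is trivial, and when that is the case the class $\mathfrak{Jac}(A)$ is the image under the inflation map $$\inf:H^1(\mathrm{Out}(A),A^\times\cap Z(A))\to H^1(\mathrm{Aut}(A),A^\times)$$ of exactly one element $\underline{\mathfrak{Jac}}(A)$ of $H^1(\mathrm{Out}(A),A^\times\cap Z(A))$.
   Context: $\Bbbk$ is a field; algebras are associative and unital over $\Bbbk$. A Frobenius algebra is a finite-dimensional algebra $A$ endowed with a non-degenerate bilinear form $\langle-,-\rangle:A\times A\to\Bbbk$ that is associative: $\langle ab,c\rangle=\langle a,bc\rangle$ for all $a,b,c\in A$. Its Nakayama automorphism is the unique algebra automorphism $\sigma:A\to A$ such that $\langle a,b\rangle=\langle b,\sigma(a)\rangle$ for all $a,b\in A$. $A$ is symmetric if it admits a non-degenerate associative bilinear form that is symmetric. For an algebra endomorphism $u:A\to A$, the Nakayama Jacobian $\mathrm{jac}_\sigma(u)$ is the unique element of $A$ such that $\langle u(a),u(b)\rangle=\langle\mathrm{jac}_\sigma(u)\cdot a,b\rangle$ for all $a,b\in A$; it is a unit when $u$ is an automorphism. Non-abelian cohomology: for a group $G$ acting on a group $M$ by automorphisms, a $1$-cocycle is a function $f:G\to M$ with $f(gh)=f(g)\cdot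 g(f(h))$; two cocycles $f,f'$ are cohomologous if there is $\xi\in M$ with $f'(g)=\xi^{-1}\cdot f(g)\cdot g(\xi)$ for all $g$; $H^1(G,M)$ is the pointed set of classes, with trivial element the class of the constant cocycle $1$. $\mathrm{Aut}(A)$ is the group of algebra automorphisms of $A$, acting by evaluation on the group of units $A^\times$; $\mathrm{Inn}(A)$ is its normal subgroup of inner automorphisms $a\mapsto sas^{-1}$, $s\in A^\times$; $\mathrm{Out}(A)=\mathrm{Aut}(A)/\mathrm{Inn}(A)$, which acts on the group $A^\times\cap Z(A)$ of central units ($Z(A)$ is the center of $A$). The class $\mathfrak{Jac}(A)\in H^1(\mathrm{Aut}(A),A^\times)$ is the class of the $1$-cocycle $u\mapsto\mathrm{jac}_\sigma(u^{-1})$; it does not depend on the chosen bilinear form. The inflation map sends the class of a cocycle $f:\mathrm{Out}(A)\to A^\times\cap Z(A)$ to the class of the composite $\mathrm{Aut}(A)\to\mathrm{Out}(A)\xrightarrow{f}A^\times\cap Z(A)\hookrightarrow A^\times$. *)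

theory Defs
  imports Complex_Main "HOL-Algebra.Coset" "HOL-Library.FuncSet"
begin

section \<open>Non-abelian first cohomology\<close>

text \<open>
  A group \<open>G\<close> acts on a group \<open>M\<close> through \<open>act\<close>. Cocycles are extensional, so that two cocycles
  are equal as soon as they agree on the carrier of \<open>G\<close>.
\<close>

definition cocycles ::
  "('g, 'x) monoid_scheme \<Rightarrow> ('m, 'y) monoid_scheme \<Rightarrow> ('g \<Rightarrow> 'm \<Rightarrow> 'm) \<Rightarrow> ('g \<Rightarrow> 'm) set"
  where "cocycles G M act =
    {f \<in> carrier G \<rightarrow>\<^sub>E carrier M.
       \<forall>g\<in>carrier G. \<forall>h\<in>carrier G. f (g \<otimes>\<^bsub>G\<^esub> h) = f g \<otimes>\<^bsub>M\<^esub> act g (f h)}"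

definition cohomologous ::
  "('g, 'x) monoid_scheme \<Rightarrow> ('m, 'y) monoid_scheme \<Rightarrow> ('g \<Rightarrow> 'm \<Rightarrow> 'm)
     \<Rightarrow> (('g \<Rightarrow> 'm) \<times> ('g \<Rightarrow> 'm)) set"
  where "cohomologous G M act =
    {(f, f'). f \<in> cocycles G M act \<and> f' \<in> cocycles G M act \<and>
       (\<exists>\<xi>\<in>carrier M. \<forall>g\<in>carrier G. f' g = inv\<^bsub>M\<^esub> \<xi> \<otimes>\<^bsub>M\<^esub> f g \<otimes>\<^bsub>M\<^esub> act g \<xi>)}"

definition H1 ::
  "('g, 'x) monoid_scheme \<Rightarrow> ('m, 'y) monoid_scheme \<Rightarrow> ('g \<Rightarrow> 'm \<Rightarrow> 'm) \<Rightarrow> ('g \<Rightarrow> 'm) set set"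
  where "H1 G M act = cocycles G M act // cohomologous G M act"

definition H1_class ::
  "('g, 'x) monoid_scheme \<Rightarrow> ('m, 'y) monoid_scheme \<Rightarrow> ('g \<Rightarrow> 'm \<Rightarrow> 'm)
     \<Rightarrow> ('g \<Rightarrow> 'm) \<Rightarrow> ('g \<Rightarrow> 'm) set"
  where "H1_class G M act f = cohomologous G M act `` {f}"

definition H1_trivial ::
  "('g, 'x) monoid_scheme \<Rightarrow> ('m, 'y) monoid_scheme \<Rightarrow> ('g \<Rightarrow> 'm \<Rightarrow> 'm) \<Rightarrow> ('g \<Rightarrow> 'm) set"
  where "H1_trivial G M act = H1_class G M act (\<lambda>g\<in>carrier G. \<one>\<^bsub>M\<^esub>)"

text \<open>
  The map on classes induced by \<open>f \<mapsto> f \<circ> \<phi>\<close> for a homomorphism \<open>\<phi>\<close> from \<open>G\<close> to the group acting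
  on the original coefficients, which may form a smaller subgroup of \<open>M\<close>. The union is over
  representatives of the class \<open>c\<close>; all of them contribute the same class
  (lemma \<open>H1_pullback_class\<close> below).
\<close>

definition H1_pullback ::
  "('g, 'x) monoid_scheme \<Rightarrow> ('m, 'y) monoid_scheme \<Rightarrow> ('g \<Rightarrow> 'm \<Rightarrow> 'm) \<Rightarrow> ('g \<Rightarrow> 'h)
     \<Rightarrow> ('h \<Rightarrow> 'm) set \<Rightarrow> ('g \<Rightarrow> 'm) set"
  where "H1_pullback G M act \<phi> c = (\<Union>f\<in>c. H1_class G M act (\<lambda>g\<in>carrier G. f (\<phi> g)))"


section \<open>Frobenius algebras\<close>

text \<open>
  The sort \<open>{ring, monoid_mult}\<close> is that of associative unital rings in which \<open>1 = 0\<close> is allowed,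
  whereas \<open>ring_1\<close> would exclude the zero algebra.
\<close>

locale fd_algebra = vector_space scale
  for scale :: "'k::field \<Rightarrow> 'a::{ring,monoid_mult} \<Rightarrow> 'a" +
  assumes scale_mult_left: "scale c a * b = scale c (a * b)"
    and scale_mult_right: "a * scale c b = scale c (a * b)"
    and finite_dim: "\<exists>B. finite B \<and> span B = UNIV"

locale frobenius_algebra = fd_algebra scale
  for scale :: "'k::field \<Rightarrow> 'a::{ring,monoid_mult} \<Rightarrow> 'a" +
  fixes form :: "'a \<Rightarrow> 'a \<Rightarrow> 'k"
  assumes form_linear_right: "Vector_Spaces.linear scale (*) (\<lambda>b. form a b)"
    and form_linear_left: "Vector_Spaces.linear scale (*) (\<lambda>a. form a b)"
    and nondegenerate_left: "(\<And>b. form a b = 0) \<Longrightarrow> a = 0"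
    and nondegenerate_right: "(\<And>a. form a b = 0) \<Longrightarrow> b = 0"
    and form_assoc: "form (a * b) c = form a (b * c)"

definition symmetric_algebra :: "('k::field \<Rightarrow> 'a::{ring,monoid_mult} \<Rightarrow> 'a) \<Rightarrow> bool"
  where "symmetric_algebra scale \<longleftrightarrow>
    (\<exists>form. frobenius_algebra scale form \<and> (\<forall>a b. form a b = form b a))"


section \<open>Units and automorphisms\<close>

definition unit_group :: "'a::monoid_mult monoid"
  where "unit_group = units_of \<lparr>carrier = UNIV, monoid.mult = (*), one = 1\<rparr>"

definition central_unit_group :: "'a::monoid_mult monoid"
  where "central_unit_group = unit_group\<lparr>carrier := {s \<in> carrier unit_group. \<forall>a. s * a = a * s}\<rparr>"

definition algebra_auts :: "('k::field \<Rightarrow> 'a::{ring,monoid_mult} \<Rightarrow> 'a) \<Rightarrow> ('a \<Rightarrow> 'a) set"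
  where "algebra_auts scale =
    {u. bij u \<and> Vector_Spaces.linear scale scale u \<and> (\<forall>a b. u (a * b) = u a * u b) \<and> u 1 = 1}"

definition Aut :: "('k::field \<Rightarrow> 'a::{ring,monoid_mult} \<Rightarrow> 'a) \<Rightarrow> ('a \<Rightarrow> 'a) monoid"
  where "Aut scale = \<lparr>carrier = algebra_auts scale, monoid.mult = (\<circ>), one = id\<rparr>"

definition inner_auts :: "('a::monoid_mult \<Rightarrow> 'a) set"
  where "inner_auts = {(\<lambda>a. s * a * inv\<^bsub>unit_group\<^esub> s) | s. s \<in> carrier unit_group}"

definition Inn :: "('k::field \<Rightarrow> 'a::{ring,monoid_mult} \<Rightarrow> 'a) \<Rightarrow> ('a \<Rightarrow> 'a) monoid"
  where "Inn scale = (Aut scale)\<lparr>carrier := inner_auts\<rparr>"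

definition Out :: "('k::field \<Rightarrow> 'a::{ring,monoid_mult} \<Rightarrow> 'a) \<Rightarrow> ('a \<Rightarrow> 'a) set monoid"
  where "Out scale = Aut scale Mod inner_auts"

definition aut_act :: "('a \<Rightarrow> 'a) \<Rightarrow> 'a \<Rightarrow> 'a"
  where "aut_act u a = u a"

text \<open>
  Elements of \<open>Out scale\<close> are cosets of automorphisms, and all members of a coset take the same
  value at a central unit (lemma \<open>out_act_coset\<close> below).
\<close>

definition out_act :: "('a \<Rightarrow> 'a) set \<Rightarrow> 'a \<Rightarrow> 'a"
  where "out_act C z = (THE w. \<forall>u\<in>C. u z = w)"

definition H1_res ::
  "('k::field \<Rightarrow> 'a::{ring,monoid_mult} \<Rightarrow> 'a) \<Rightarrow> (('a \<Rightarrow> 'a) \<Rightarrow> 'a) set \<Rightarrow> (('a \<Rightarrow> 'a) \<Rightarrow> 'a) set"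
  where "H1_res scale = H1_pullback (Inn scale) unit_group aut_act (\<lambda>u. u)"

definition H1_inf ::
  "('k::field \<Rightarrow> 'a::{ring,monoid_mult} \<Rightarrow> 'a)
     \<Rightarrow> (('a \<Rightarrow> 'a) set \<Rightarrow> 'a) set \<Rightarrow> (('a \<Rightarrow> 'a) \<Rightarrow> 'a) set"
  where "H1_inf scale =
    H1_pullback (Aut scale) unit_group aut_act (\<lambda>u. inner_auts #>\<^bsub>Aut scale\<^esub> u)"


section \<open>The Nakayama Jacobian\<close>

definition nakayama_jac :: "('a::times \<Rightarrow> 'a \<Rightarrow> 'k) \<Rightarrow> ('a \<Rightarrow> 'a) \<Rightarrow> 'a"
  where "nakayama_jac form u = (THE j. \<forall>a b. form (u a) (u b) = form (j * a) b)"

definition jac_cocycle ::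
  "('k::field \<Rightarrow> 'a::{ring,monoid_mult} \<Rightarrow> 'a) \<Rightarrow> ('a \<Rightarrow> 'a \<Rightarrow> 'k) \<Rightarrow> ('a \<Rightarrow> 'a) \<Rightarrow> 'a"
  where "jac_cocycle scale form =
    (\<lambda>u\<in>carrier (Aut scale). nakayama_jac form (inv\<^bsub>Aut scale\<^esub> u))"

definition Jac ::
  "('k::field \<Rightarrow> 'a::{ring,monoid_mult} \<Rightarrow> 'a) \<Rightarrow> ('a \<Rightarrow> 'a \<Rightarrow> 'k) \<Rightarrow> (('a \<Rightarrow> 'a) \<Rightarrow> 'a) set"
  where "Jac scale form = H1_class (Aut scale) unit_group aut_act (jac_cocycle scale form)"


section \<open>Well-definedness\<close>

lemma cohomologous_equiv:
  fixes G (structure) and M (structure)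
  assumes "group M" and act: "\<And>g. g \<in> carrier G \<Longrightarrow> act g \<in> hom M M"
  shows "equiv (cocycles G M act) (cohomologous G M act)"
proof -
  interpret M: group M by fact
  have cl: "act g x \<in> carrier M" if "g \<in> carrier G" "x \<in> carrier M" for g x
    using act that by (auto simp: hom_def)
  have ml: "act g (x \<otimes>\<^bsub>M\<^esub> y) = act g x \<otimes>\<^bsub>M\<^esub> act g y"
    if "g \<in> carrier G" "x \<in> carrier M" "y \<in> carrier M" for g x y
    using act that by (auto simp: hom_def)
  have one: "act g \<one>\<^bsub>M\<^esub> = \<one>\<^bsub>M\<^esub>" if "g \<in> carrier G" for g
    using act[OF that] assms(1) by (simp add: hom_one)
  have fc: "f g \<in> carrier M" if "f \<in> cocycles G M act" "g \<in> carrier G" for f g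
    using that by (auto simp: cocycles_def)
  show ?thesis
  proof (rule equivI)
    show "cohomologous G M act \<subseteq> cocycles G M act \<times> cocycles G M act"
      by (auto simp: cohomologous_def)
    show "refl_on (cocycles G M act) (cohomologous G M act)"
    proof (rule refl_onI)
      fix f assume f: "f \<in> cocycles G M act"
      show "(f, f) \<in> cohomologous G M act"
        using f fc[OF f] one by (auto simp: cohomologous_def intro!: bexI[of _ "\<one>\<^bsub>M\<^esub>"])
    qed
    show "sym (cohomologous G M act)"
    proof (rule symI)
      fix f f' assume "(f, f') \<in> cohomologous G M act"
      then obtain \<xi> where f: "f \<in> cocycles G M act" "f' \<in> cocycles G M act" "\<xi> \<in> carrier M"
        and e: "\<And>g. g \<in> carrier G \<Longrightarrow> f' g = inv\<^bsub>M\<^esub> \<xi> \<otimes>\<^bsub>M\<^esub> f g \<otimes>\<^bsub>M\<^esub> act g \<xi>"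
        by (auto simp: cohomologous_def)
      have "f g = inv\<^bsub>M\<^esub> (inv\<^bsub>M\<^esub> \<xi>) \<otimes>\<^bsub>M\<^esub> f' g \<otimes>\<^bsub>M\<^esub> act g (inv\<^bsub>M\<^esub> \<xi>)" if g: "g \<in> carrier G" for g
      proof -
        have c: "act g \<xi> \<otimes>\<^bsub>M\<^esub> act g (inv\<^bsub>M\<^esub> \<xi>) = \<one>\<^bsub>M\<^esub>"
          using ml[OF g, of \<xi> "inv\<^bsub>M\<^esub> \<xi>"] f one[OF g] by simp
        have "inv\<^bsub>M\<^esub> (inv\<^bsub>M\<^esub> \<xi>) \<otimes>\<^bsub>M\<^esub> f' g \<otimes>\<^bsub>M\<^esub> act g (inv\<^bsub>M\<^esub> \<xi>)
          = \<xi> \<otimes>\<^bsub>M\<^esub> inv\<^bsub>M\<^esub> \<xi> \<otimes>\<^bsub>M\<^esub> f g \<otimes>\<^bsub>M\<^esub> (act g \<xi> \<otimes>\<^bsub>M\<^esub> act g (inv\<^bsub>M\<^esub> \<xi>))"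
          using f fc[OF f(1) g] cl[OF g] by (simp add: e[OF g] M.m_assoc del: M.r_inv M.Units_r_inv)
        then show ?thesis using f fc[OF f(1) g] c by simp
      qed
      then show "(f', f) \<in> cohomologous G M act"
        using f by (auto simp: cohomologous_def intro!: bexI[of _ "inv\<^bsub>M\<^esub> \<xi>"])
    qed
    show "trans (cohomologous G M act)"
    proof (rule transI)
      fix f f' f'' assume "(f, f') \<in> cohomologous G M act" "(f', f'') \<in> cohomologous G M act"
      then obtain \<xi> \<eta> where f: "f \<in> cocycles G M act" "f'' \<in> cocycles G M act"
          "\<xi> \<in> carrier M" "\<eta> \<in> carrier M"
        and e: "\<And>g. g \<in> carrier G \<Longrightarrow> f' g = inv\<^bsub>M\<^esub> \<xi> \<otimes>\<^bsub>M\<^esub> f g \<otimes>\<^bsub>M\<^esub> act g \<xi>"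
          "\<And>g. g \<in> carrier G \<Longrightarrow> f'' g = inv\<^bsub>M\<^esub> \<eta> \<otimes>\<^bsub>M\<^esub> f' g \<otimes>\<^bsub>M\<^esub> act g \<eta>"
        by (auto simp: cohomologous_def)
      have "f'' g = inv\<^bsub>M\<^esub> (\<xi> \<otimes>\<^bsub>M\<^esub> \<eta>) \<otimes>\<^bsub>M\<^esub> f g \<otimes>\<^bsub>M\<^esub> act g (\<xi> \<otimes>\<^bsub>M\<^esub> \<eta>)" if g: "g \<in> carrier G" for g
        using f fc[OF f(1) g] cl[OF g]
        by (simp add: e[OF g] ml[OF g] M.inv_mult_group M.m_assoc)
      then show "(f, f'') \<in> cohomologous G M act"
        using f by (auto simp: cohomologous_def intro!: bexI[of _ "\<xi> \<otimes>\<^bsub>M\<^esub> \<eta>"])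
    qed
  qed
qed

lemma H1_pullback_class:
  assumes M: "group M" and act: "\<And>g. g \<in> carrier G \<Longrightarrow> act g \<in> hom M M"
    and N: "subgroup N M" and act': "\<And>h. h \<in> carrier H \<Longrightarrow> act' h \<in> hom (M\<lparr>carrier := N\<rparr>) (M\<lparr>carrier := N\<rparr>)"
    and G: "group G" and phi: "\<phi> \<in> hom G H"
    and compat: "\<And>g x. g \<in> carrier G \<Longrightarrow> x \<in> N \<Longrightarrow> act' (\<phi> g) x = act g x"
    and f: "f \<in> cocycles H (M\<lparr>carrier := N\<rparr>) act'"
  shows "(\<lambda>g\<in>carrier G. f (\<phi> g)) \<in> cocycles G M act" (is ?A)
    and "H1_pullback G M act \<phi> (H1_class H (M\<lparr>carrier := N\<rparr>) act' f)
           = H1_class G M act (\<lambda>g\<in>carrier G. f (\<phi> g))" (is ?B)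
proof -
  interpret M: group M by fact
  interpret G: group G by fact
  have sub: "N \<subseteq> carrier M" using N by (rule subgroup.subset)
  have ph: "\<phi> g \<in> carrier H" if "g \<in> carrier G" for g using phi that by (auto simp: hom_def)
  have coc: "(\<lambda>g\<in>carrier G. f (\<phi> g)) \<in> cocycles G M act"
    if f: "f \<in> cocycles H (M\<lparr>carrier := N\<rparr>) act'" for f
  proof -
    have "f (\<phi> g) \<in> N" if "g \<in> carrier G" for g using f ph[OF that] by (auto simp: cocycles_def)
    then show ?thesis
      using f sub phi ph compat by (auto simp: cocycles_def hom_def)
  qed
  show ?A by (rule coc[OF f])
  have E: "equiv (cocycles G M act) (cohomologous G M act)"
    by (rule cohomologous_equiv[OF M act])
  have E': "equiv (cocycles H (M\<lparr>carrier := N\<rparr>) act') (cohomologous H (M\<lparr>carrier := N\<rparr>) act')"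
    by (rule cohomologous_equiv[OF subgroup.subgroup_is_group[OF N M] act'])
  have eq: "H1_class G M act (\<lambda>g\<in>carrier G. f' (\<phi> g)) = H1_class G M act (\<lambda>g\<in>carrier G. f (\<phi> g))"
    if f': "(f, f') \<in> cohomologous H (M\<lparr>carrier := N\<rparr>) act'" for f'
  proof -
    from f' obtain \<xi> where x: "\<xi> \<in> N" "f' \<in> cocycles H (M\<lparr>carrier := N\<rparr>) act'"
      and e: "\<And>h. h \<in> carrier H \<Longrightarrow> f' h = inv\<^bsub>M\<lparr>carrier := N\<rparr>\<^esub> \<xi> \<otimes>\<^bsub>M\<^esub> f h \<otimes>\<^bsub>M\<^esub> act' h \<xi>"
      by (auto simp: cohomologous_def)
    have "inv\<^bsub>M\<lparr>carrier := N\<rparr>\<^esub> \<xi> = inv\<^bsub>M\<^esub> \<xi>" using M.m_inv_consistent[OF N x(1)] by simp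
    then have "((\<lambda>g\<in>carrier G. f (\<phi> g)), (\<lambda>g\<in>carrier G. f' (\<phi> g))) \<in> cohomologous G M act"
      using coc[OF f] coc[OF x(2)] x sub e ph compat
      by (auto simp: cohomologous_def intro!: bexI[of _ \<xi>])
    then show ?thesis unfolding H1_class_def using equiv_class_eq[OF E] by simp
  qed
  have "(f, f) \<in> cohomologous H (M\<lparr>carrier := N\<rparr>) act'"
    using E' f by (simp add: equiv_def refl_on_def)
  then have "f \<in> H1_class H (M\<lparr>carrier := N\<rparr>) act' f" by (simp add: H1_class_def)
  moreover have "H1_class G M act (\<lambda>g\<in>carrier G. f' (\<phi> g)) = H1_class G M act (\<lambda>g\<in>carrier G. f (\<phi> g))"
    if "f' \<in> H1_class H (M\<lparr>carrier := N\<rparr>) act' f" for f'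
    using that eq unfolding H1_class_def[of H] by blast
  ultimately show ?B
    unfolding H1_pullback_def by blast
qed

lemma unit_group_simps [simp]:
  "monoid.mult unit_group = (*)" "one unit_group = 1"
  "monoid.mult central_unit_group = (*)" "one central_unit_group = 1"
  by (simp_all add: unit_group_def units_of_def central_unit_group_def)

lemma carrier_unit_group: "carrier unit_group = {s. \<exists>t. t * s = 1 \<and> s * t = 1}"
  by (simp add: unit_group_def units_of_def Units_def)

lemma group_unit_group: "group (unit_group :: 'a::monoid_mult monoid)"
proof -
  have "monoid \<lparr>carrier = UNIV :: 'a set, monoid.mult = (*), one = 1\<rparr>"
    by unfold_locales (auto simp: mult.assoc)
  then show ?thesis unfolding unit_group_def by (rule monoid.units_group)
qed

lemma subgroup_central_units:
  "subgroup {s \<in> carrier unit_group. \<forall>a. s * a = a * s} (unit_group :: 'a::monoid_mult monoid)"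
proof -
  interpret U: group "unit_group :: 'a monoid" by (rule group_unit_group)
  show ?thesis
  proof (rule U.subgroupI)
    fix s :: 'a assume s: "s \<in> {s \<in> carrier unit_group. \<forall>a. s * a = a * s}"
    let ?t = "inv\<^bsub>unit_group\<^esub> s"
    from s have su: "s \<in> carrier unit_group" and sc: "a * s = s * a" for a by (blast, metis (mono_tags, lifting) mem_Collect_eq)
    have t: "?t * s = 1" "s * ?t = 1" using U.l_inv[OF su] U.r_inv[OF su] by simp_all
    have tc: "?t * a = a * ?t" for a
    proof -
      have "?t * a = ?t * (a * s) * ?t" using t by (simp add: mult.assoc)
      also have "\<dots> = ?t * (s * a) * ?t" by (simp only: sc)
      also have "\<dots> = a * ?t" by (metis t(1) mult.assoc mult_1_left)
      finally show ?thesis .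
    qed
    show "?t \<in> {s \<in> carrier unit_group. \<forall>a. s * a = a * s}"
      using U.inv_closed[OF su] tc by blast
  next
    fix s t :: 'a assume s: "s \<in> {s \<in> carrier unit_group. \<forall>a. s * a = a * s}"
      and t: "t \<in> {s \<in> carrier unit_group. \<forall>a. s * a = a * s}"
    from s t have su: "s \<in> carrier unit_group" and tu: "t \<in> carrier unit_group"
      and sc: "s * a = a * s" and tc: "t * a = a * t" for a by blast+
    have "s * t \<in> carrier unit_group" using U.m_closed[OF su tu] by simp
    moreover have "s * t * a = a * (s * t)" for a by (metis sc tc mult.assoc)
    ultimately show "s \<otimes>\<^bsub>unit_group\<^esub> t \<in> {s \<in> carrier unit_group. \<forall>a. s * a = a * s}"
      unfolding unit_group_simps by blast
  next
    have "1 \<in> {s \<in> carrier unit_group. \<forall>a :: 'a. s * a = a * s}"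
      using U.one_closed by (simp)
    then show "{s \<in> carrier unit_group. \<forall>a :: 'a. s * a = a * s} \<noteq> {}" by blast
  qed blast
qed

lemma group_central_unit_group: "group (central_unit_group :: 'a::monoid_mult monoid)"
  unfolding central_unit_group_def
  using subgroup_central_units group_unit_group by (rule subgroup.subgroup_is_group)

context fd_algebra
begin

lemma Aut_simps [simp]:
  "carrier (Aut scale) = algebra_auts scale" "monoid.mult (Aut scale) = (\<circ>)" "one (Aut scale) = id"
  "carrier (Inn scale) = inner_auts" "monoid.mult (Inn scale) = (\<circ>)" "one (Inn scale) = id"
  by (simp_all add: Aut_def Inn_def)

lemma linear_iff_local:
  "Vector_Spaces.linear scale scale u \<longleftrightarrow>
     (\<forall>x y. u (x + y) = u x + u y) \<and> (\<forall>c x. u (scale c x) = scale c (u x))"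
  using vector_space_axioms unfolding module_hom_eq_linear[symmetric] module_hom_iff module_iff_vector_space by blast

lemma inv_algebra_auts:
  assumes u: "u \<in> algebra_auts scale"
  shows "inv_into UNIV u \<in> algebra_auts scale" "inv_into UNIV u \<circ> u = id" "u \<circ> inv_into UNIV u = id"
proof -
  have b: "bij u" using u by (simp add: algebra_auts_def)
  have ui: "u (inv_into UNIV u x) = x" for x using b by (simp add: bij_is_surj surj_f_inv_f)
  have inj: "u x = u y \<Longrightarrow> x = y" for x y using b by (meson bij_is_inj injD)
  have m: "\<And>x y. u (x + y) = u x + u y" "\<And>c x. u (scale c x) = scale c (u x)"
      "\<And>x y. u (x * y) = u x * u y" "u 1 = 1"
    using u by (simp_all add: algebra_auts_def linear_iff_local)
  have "inv_into UNIV u (x + y) = inv_into UNIV u x + inv_into UNIV u y" for x y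
    by (rule inj) (simp add: m ui)
  moreover have "inv_into UNIV u (scale c x) = scale c (inv_into UNIV u x)" for c x
    by (rule inj) (simp add: m ui)
  moreover have "inv_into UNIV u (x * y) = inv_into UNIV u x * inv_into UNIV u y" for x y
    by (rule inj) (simp add: m ui)
  moreover have "inv_into UNIV u 1 = 1" by (rule inj) (simp add: m ui)
  ultimately show "inv_into UNIV u \<in> algebra_auts scale"
    using bij_imp_bij_inv[OF b] by (simp add: algebra_auts_def linear_iff_local)
  show "inv_into UNIV u \<circ> u = id" using b by (simp add: bij_is_inj)
  show "u \<circ> inv_into UNIV u = id" by (simp add: fun_eq_iff ui)
qed

lemma group_Aut: "group (Aut scale)"
proof (rule groupI)
  show "\<exists>y\<in>carrier (Aut scale). y \<otimes>\<^bsub>Aut scale\<^esub> x = \<one>\<^bsub>Aut scale\<^esub>" if "x \<in> carrier (Aut scale)" for x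
    using inv_algebra_auts that by auto
qed (auto simp: algebra_auts_def linear_iff_local bij_comp comp_assoc)

lemma inv_Aut: "u \<in> algebra_auts scale \<Longrightarrow> inv\<^bsub>Aut scale\<^esub> u = inv_into UNIV u"
  using group.inv_equality[OF group_Aut, of "inv_into UNIV u" u] inv_algebra_auts by simp

lemma unit_inv:
  fixes s :: 'a
  assumes "s \<in> carrier unit_group"
  shows "inv\<^bsub>unit_group\<^esub> s * s = 1" "s * inv\<^bsub>unit_group\<^esub> s = 1" "inv\<^bsub>unit_group\<^esub> s \<in> carrier unit_group"
  using group.l_inv[OF group_unit_group assms] group.r_inv[OF group_unit_group assms]
    group.inv_closed[OF group_unit_group assms] by simp_all

lemma conj_in_Aut:
  fixes s t :: 'a
  assumes "t * s = 1" "s * t = 1"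
  shows "(\<lambda>a. s * a * t) \<in> algebra_auts scale"
proof -
  have c: "t * (s * x) = x" "s * (t * x) = x" for x
    using assms by (simp_all flip: mult.assoc)
  have "bij (\<lambda>a. s * a * t)"
    by (rule o_bij[of "\<lambda>a. t * a * s"]) (auto simp: mult.assoc c assms)
  then show ?thesis
    by (auto simp: algebra_auts_def linear_iff_local scale_mult_left scale_mult_right
        distrib_left distrib_right mult.assoc c assms)
qed

lemma inner_auts_iff:
  "u \<in> inner_auts \<longleftrightarrow> (\<exists>s t :: 'a. t * s = 1 \<and> s * t = 1 \<and> u = (\<lambda>a. s * a * t))"
proof
  assume "u \<in> inner_auts"
  then show "\<exists>s t. t * s = 1 \<and> s * t = 1 \<and> u = (\<lambda>a. s * a * t)"
    using unit_inv by (auto simp: inner_auts_def)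
next
  assume "\<exists>s t. t * s = 1 \<and> s * t = 1 \<and> u = (\<lambda>a. s * a * t)"
  then obtain s t where st: "t * s = 1" "s * t = 1" "u = (\<lambda>a. s * a * t)" by blast
  then have "s \<in> carrier unit_group" "t \<in> carrier unit_group" by (auto simp: carrier_unit_group)
  moreover from this have "inv\<^bsub>unit_group\<^esub> s = t"
    using group.inv_equality[OF group_unit_group, of t s] st by simp
  ultimately show "u \<in> inner_auts" using st by (auto simp: inner_auts_def)
qed

lemma subgroup_Inn: "subgroup inner_auts (Aut scale)"
proof (rule group.subgroupI[OF group_Aut])
  show "inner_auts \<subseteq> carrier (Aut scale)" using conj_in_Aut by (auto simp: inner_auts_iff)
  show "inner_auts \<noteq> ({} :: ('a \<Rightarrow> 'a) set)"
  proof -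
    have "(\<lambda>a :: 'a. 1 * a * 1) \<in> inner_auts" unfolding inner_auts_iff by (metis mult_1_left)
    then show ?thesis by blast
  qed
next
  fix u :: "'a \<Rightarrow> 'a" assume "u \<in> inner_auts"
  then obtain s t where st: "t * s = 1" "s * t = 1" "u = (\<lambda>a. s * a * t)"
    by (auto simp: inner_auts_iff)
  have c: "t * (s * x) = x" "s * (t * x) = x" for x
    using st by (simp_all flip: mult.assoc)
  have "inv\<^bsub>Aut scale\<^esub> u = (\<lambda>a. t * a * s)"
    using st conj_in_Aut[of t s] conj_in_Aut[of s t]
    by (intro group.inv_equality[OF group_Aut]) (auto simp: mult.assoc c)
  then show "inv\<^bsub>Aut scale\<^esub> u \<in> inner_auts" using st by (auto simp: inner_auts_iff)
next
  fix u v :: "'a \<Rightarrow> 'a" assume "u \<in> inner_auts" "v \<in> inner_auts"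
  then obtain s t p q where st: "t * s = 1" "s * t = 1" "u = (\<lambda>a. s * a * t)"
      "q * p = 1" "p * q = 1" "v = (\<lambda>a. p * a * q)"
    by (auto simp: inner_auts_iff)
  have c: "t * (s * x) = x" "p * (q * x) = x" for x
    using st by (simp_all flip: mult.assoc)
  have "(q * t) * (s * p) = 1" "(s * p) * (q * t) = 1"
    using st c by (simp_all add: mult.assoc)
  moreover have "u \<circ> v = (\<lambda>a. (s * p) * a * (q * t))" by (auto simp: st mult.assoc)
  ultimately show "u \<otimes>\<^bsub>Aut scale\<^esub> v \<in> inner_auts" by (auto simp: inner_auts_iff)
qed

lemma normal_Inn: "inner_auts \<lhd> Aut scale"
proof -
  have "u \<circ> h \<circ> inv_into UNIV u \<in> inner_auts" if u: "u \<in> algebra_auts scale" and h: "h \<in> inner_auts" for u h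
  proof -
    from h obtain s t where st: "t * s = 1" "s * t = 1" "h = (\<lambda>a. s * a * t)"
      by (auto simp: inner_auts_iff)
    have m: "\<And>a b. u (a * b) = u a * u b" "u 1 = 1" using u by (auto simp: algebra_auts_def)
    have i: "\<And>a. u (inv_into UNIV u a) = a" using inv_algebra_auts(3)[OF u] by (metis comp_apply id_apply)
    have "u \<circ> h \<circ> inv_into UNIV u = (\<lambda>a. u s * a * u t)" by (auto simp: st m i)
    moreover have "u t * u s = 1" "u s * u t = 1" using st m by metis+
    ultimately show ?thesis by (auto simp: inner_auts_iff)
  qed
  then show ?thesis
    using subgroup_Inn by (auto simp: group.normal_inv_iff[OF group_Aut] inv_Aut)
qed

lemma group_Out: "group (Out scale)"
  unfolding Out_def using normal_Inn by (rule normal.factorgroup_is_group)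

lemma group_Inn: "group (Inn scale)"
  unfolding Inn_def using subgroup_Inn group_Aut by (rule subgroup.subgroup_is_group)

lemma aut_act_hom:
  assumes u: "u \<in> algebra_auts scale"
  shows "aut_act u \<in> hom unit_group unit_group"
    and "aut_act u \<in> hom central_unit_group central_unit_group"
proof -
  have m: "\<And>a b. u (a * b) = u a * u b" "u 1 = 1" using u by (auto simp: algebra_auts_def)
  have i: "\<And>a. u (inv_into UNIV u a) = a" using inv_algebra_auts(3)[OF u] by (metis comp_apply id_apply)
  have un: "u s \<in> carrier unit_group" if "s \<in> carrier unit_group" for s
  proof -
    from that obtain t where "t * s = 1" "s * t = 1" by (auto simp: carrier_unit_group)
    then have "u t * u s = 1" "u s * u t = 1" using m by metis+
    then show ?thesis by (auto simp: carrier_unit_group)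
  qed
  then show "aut_act u \<in> hom unit_group unit_group" by (auto simp: hom_def aut_act_def m)
  have "u s * a = a * u s" if "\<forall>a. s * a = a * s" for s a
    using that m i by metis
  with un have "u s \<in> {s \<in> carrier unit_group. \<forall>a. s * a = a * s}"
    if "s \<in> {s \<in> carrier unit_group. \<forall>a. s * a = a * s}" for s
    using that by blast
  then have "u s \<in> carrier central_unit_group" if "s \<in> carrier central_unit_group" for s
    using that unfolding central_unit_group_def by simp
  then show "aut_act u \<in> hom central_unit_group central_unit_group"
    by (simp add: hom_def aut_act_def m Pi_def)
qed

lemma out_act_coset:
  assumes u: "u \<in> carrier (Aut scale)" and z: "z \<in> carrier central_unit_group"
  shows "out_act (inner_auts #>\<^bsub>Aut scale\<^esub> u) z = u z"
proof -
  have "aut_act u z \<in> carrier central_unit_group"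
    using aut_act_hom(2)[of u] u z by (simp add: hom_in_carrier)
  then have c: "a * u z = u z * a" for a
    unfolding central_unit_group_def aut_act_def by simp
  have "v z = u z" if "v \<in> inner_auts #>\<^bsub>Aut scale\<^esub> u" for v
  proof -
    from that obtain h where h: "h \<in> inner_auts" "v = h \<circ> u" by (auto simp: r_coset_def)
    then obtain s t where st: "t * s = 1" "s * t = 1" "h = (\<lambda>a. s * a * t)"
      by (auto simp: inner_auts_iff)
    have "v z = s * u z * t" by (simp add: h st)
    also have "\<dots> = u z * (s * t)" using c[of s] by (simp add: mult.assoc)
    finally show ?thesis using st by simp
  qed
  moreover have "u \<in> inner_auts #>\<^bsub>Aut scale\<^esub> u"
    using group.rcos_self[OF group_Aut u subgroup_Inn] .
  ultimately show ?thesis unfolding out_act_def by (intro the_equality) (blast, metis)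
qed

lemma out_act_hom:
  assumes "C \<in> carrier (Out scale)"
  shows "out_act C \<in> hom central_unit_group central_unit_group"
proof -
  from assms obtain u where u: "u \<in> carrier (Aut scale)" "C = inner_auts #>\<^bsub>Aut scale\<^esub> u"
    by (auto simp: Out_def carrier_FactGroup)
  have "aut_act u \<in> hom central_unit_group central_unit_group" using aut_act_hom u by simp
  moreover have "out_act C z = aut_act u z" if "z \<in> carrier central_unit_group" for z
    using out_act_coset[OF u(1) that] u by (simp add: aut_act_def)
  moreover have "x \<otimes>\<^bsub>central_unit_group\<^esub> y \<in> carrier central_unit_group"
    if "x \<in> carrier central_unit_group" "y \<in> carrier central_unit_group" for x y :: 'a
    using that by (rule monoid.m_closed[OF group.is_monoid[OF group_central_unit_group]])
  ultimately show ?thesis by (simp add: hom_def Pi_def)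
qed

lemma H1_res_class:
  assumes f: "f \<in> cocycles (Aut scale) unit_group aut_act"
  shows "H1_res scale (H1_class (Aut scale) unit_group aut_act f)
    = H1_class (Inn scale) unit_group aut_act (\<lambda>u\<in>inner_auts. f u)"
proof -
  have s: "unit_group\<lparr>carrier := carrier unit_group\<rparr> = unit_group" by simp
  have sub: "inner_auts \<subseteq> algebra_auts scale" using subgroup.subset[OF subgroup_Inn] by simp
  have "(\<lambda>u. u) \<in> hom (Inn scale) (Aut scale)" using sub by (auto simp: hom_def)
  then show ?thesis
    using H1_pullback_class(2)[of unit_group "Inn scale" aut_act "carrier unit_group" "Aut scale"
        aut_act "\<lambda>u. u" f] group_unit_group group.subgroup_self[OF group_unit_group] aut_act_hom(1)
      group_Inn f sub
    by (auto simp: H1_res_def s)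
qed

lemma H1_inf_class:
  assumes f: "f \<in> cocycles (Out scale) central_unit_group out_act"
  shows "(\<lambda>u\<in>carrier (Aut scale). f (inner_auts #>\<^bsub>Aut scale\<^esub> u)) \<in> cocycles (Aut scale) unit_group aut_act"
    and "H1_inf scale (H1_class (Out scale) central_unit_group out_act f)
      = H1_class (Aut scale) unit_group aut_act (\<lambda>u\<in>carrier (Aut scale). f (inner_auts #>\<^bsub>Aut scale\<^esub> u))"
proof -
  have s: "unit_group\<lparr>carrier := {s \<in> carrier unit_group. \<forall>a. s * a = a * s}\<rparr> = central_unit_group"
    by (simp add: central_unit_group_def)
  have h: "(\<lambda>u. inner_auts #>\<^bsub>Aut scale\<^esub> u) \<in> hom (Aut scale) (Out scale)"
    unfolding Out_def using normal.r_coset_hom_Mod[OF normal_Inn] .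
  have c: "out_act (inner_auts #>\<^bsub>Aut scale\<^esub> u) z = aut_act u z"
    if "u \<in> carrier (Aut scale)" "z \<in> {s \<in> carrier unit_group. \<forall>a. s * a = a * s}" for u z
    using out_act_coset[OF that(1), of z] that(2) unfolding s[symmetric] aut_act_def by simp
  note P = H1_pullback_class[of unit_group "Aut scale" aut_act
      "{s \<in> carrier unit_group. \<forall>a. s * a = a * s}" "Out scale" out_act
      "\<lambda>u. inner_auts #>\<^bsub>Aut scale\<^esub> u" f, unfolded s,
      OF group_unit_group aut_act_hom(1) subgroup_central_units out_act_hom group_Aut h c f]
  show "(\<lambda>u\<in>carrier (Aut scale). f (inner_auts #>\<^bsub>Aut scale\<^esub> u)) \<in> cocycles (Aut scale) unit_group aut_act"
    by (rule P(1)) auto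
  show "H1_inf scale (H1_class (Out scale) central_unit_group out_act f)
      = H1_class (Aut scale) unit_group aut_act (\<lambda>u\<in>carrier (Aut scale). f (inner_auts #>\<^bsub>Aut scale\<^esub> u))"
    unfolding H1_inf_def by (rule P(2)) auto
qed

end

context frobenius_algebra
begin

lemma form_simps:
  "form (a + a') b = form a b + form a' b" "form a (b + b') = form a b + form a b'"
  "form (scale c a) b = c * form a b" "form a (scale c b) = c * form a b"
  "form (a - a') b = form a b - form a' b"
proof -
  interpret l: Vector_Spaces.linear scale "(*)" "\<lambda>a. form a b" by (rule form_linear_left)
  interpret r: Vector_Spaces.linear scale "(*)" "\<lambda>b. form a b" by (rule form_linear_right)
  show "form (a + a') b = form a b + form a' b" "form a (b + b') = form a b + form a b'"
    "form (scale c a) b = c * form a b" "form a (scale c b) = c * form a b"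
    "form (a - a') b = form a b - form a' b"
    by (simp_all add: l.add r.add l.scale r.scale l.diff)
qed

lemma form_eqD: "(\<And>b. form a b = form a' b) \<Longrightarrow> a = a'"
  using nondegenerate_left[of "a - a'"] by (simp add: form_simps)

lemma functional_represented:
  assumes "Vector_Spaces.linear scale (*) \<phi>"
  shows "\<exists>j. \<forall>b. form j b = \<phi> b"
proof -
  interpret p: Vector_Spaces.linear scale "(*)" \<phi> by fact
  obtain B0 where B0: "finite B0" "span B0 = UNIV" using finite_dim by blast
  obtain B where B: "B \<subseteq> B0" "independent B" "B0 \<subseteq> span B"
    using maximal_independent_subset[of B0] by blast
  have fB: "finite B" using B B0 by (metis finite_subset)
  have sB: "span B = UNIV" using B B0 by (metis span_mono span_span top.extremum_unique)
  interpret fd: finite_dimensional_vector_space scale B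
    by unfold_locales (use fB sB B in auto)
  define T where "T a = (\<Sum>b\<in>B. scale (form a b) b)" for a
  have lT: "Vector_Spaces.linear scale scale T"
    by (simp add: linear_iff_local T_def form_simps scale_left_distrib sum.distrib scale_sum_right)
  have coef: "f b = g b" if "(\<Sum>b\<in>B. scale (f b) b) = (\<Sum>b\<in>B. scale (g b) b)" "b \<in> B" for f g b
  proof -
    have "(\<Sum>b\<in>B. scale (f b - g b) b) = 0"
      using that by (simp add: scale_left_diff_distrib sum_subtractf)
    then show ?thesis
      using independentD[OF B(2) fB order.refl, of "\<lambda>b. f b - g b" b] that(2) by simp
  qed
  have ext: "form j b = \<psi> b" if l: "Vector_Spaces.linear scale (*) \<psi>" and e: "\<And>b. b \<in> B \<Longrightarrow> form j b = \<psi> b"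
    for j \<psi> b
  proof -
    interpret q: Vector_Spaces.linear scale "(*)" \<psi> by fact
    have "b \<in> span B" using sB by simp
    then show ?thesis
    proof (induction rule: span_induct_alt)
      case base
      show ?case using form_simps(4)[of j 0 0] q.zero by simp
    next
      case (step c x y)
      then show ?case using e by (simp add: form_simps q.add q.scale)
    qed
  qed
  have "inj T"
  proof (rule injI)
    fix x y assume "T x = T y"
    then have "form x b = form y b" if "b \<in> B" for b using coef[of "form x" "form y" b] that by (simp add: T_def)
    then have "form x b = form y b" for b using ext[OF form_linear_right] by blast
    then show "x = y" by (rule form_eqD)
  qed
  then have "surj T" using fd.linear_inj_imp_surj[OF lT] by simp
  then obtain j where "T j = (\<Sum>b\<in>B. scale (\<phi> b) b)" by (metis surjD)
  then have "form j b = \<phi> b" if "b \<in> B" for b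
    using coef[of "form j" \<phi> b] that by (simp add: T_def)
  then show ?thesis using ext[OF assms] by blast
qed

lemma nakayama_jac_ex1:
  assumes lin: "Vector_Spaces.linear scale scale u" and m: "\<And>a b. u (a * b) = u a * u b"
  shows "\<exists>!j. \<forall>a b. form (u a) (u b) = form (j * a) b"
proof -
  have "Vector_Spaces.linear scale (*) (\<lambda>b. form (u 1) (u b))"
    using Vector_Spaces.linear_compose[OF lin form_linear_right[of "u 1"]] by (simp add: comp_def)
  then obtain j where j: "\<And>b. form j b = form (u 1) (u b)"
    using functional_represented by meson
  have "form (u a) (u b) = form (j * a) b" for a b
  proof -
    have "form (u a) (u b) = form (u 1 * u a) (u b)" by (simp flip: m)
    also have "\<dots> = form (u 1) (u (a * b))" by (simp add: form_assoc m)
    finally show ?thesis by (simp add: form_assoc flip: j)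
  qed
  moreover have "j' = j" if "\<forall>a b. form (u a) (u b) = form (j' * a) b" for j'
    using that[rule_format, of 1] j by (intro form_eqD) simp
  ultimately show ?thesis by blast
qed

lemma nakayama_jac:
  assumes "u \<in> algebra_auts scale"
  shows "form (u a) (u b) = form (nakayama_jac form u * a) b"
  using theI'[OF nakayama_jac_ex1[of u]] assms
  unfolding nakayama_jac_def[symmetric] by (simp add: algebra_auts_def)

lemma nakayama_jac_unique:
  assumes "u \<in> algebra_auts scale" and "\<And>b. form 1 (u b) = form j b"
  shows "nakayama_jac form u = j"
  using nakayama_jac[OF assms(1), of 1] assms by (intro form_eqD) (simp add: algebra_auts_def)

lemma nakayama_jac_comp:
  assumes u: "u \<in> algebra_auts scale" and v: "v \<in> algebra_auts scale"
  shows "nakayama_jac form (u \<circ> v) = nakayama_jac form v * inv_into UNIV v (nakayama_jac form u)"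
proof (rule nakayama_jac_unique)
  show "u \<circ> v \<in> algebra_auts scale"
    using monoid.m_closed[OF group.is_monoid[OF group_Aut], of u v] u v by simp
  fix b
  have i: "v (inv_into UNIV v a) = a" for a
    using inv_algebra_auts(3)[OF v] by (metis comp_apply id_apply)
  have "form 1 ((u \<circ> v) b) = form (nakayama_jac form u) (v b)"
    using nakayama_jac[OF u, of 1 "v b"] u by (simp add: algebra_auts_def)
  also have "\<dots> = form (v (inv_into UNIV v (nakayama_jac form u))) (v b)" by (simp only: i)
  also have "\<dots> = form (nakayama_jac form v * inv_into UNIV v (nakayama_jac form u)) b"
    by (rule nakayama_jac[OF v])
  finally show "form 1 ((u \<circ> v) b) = form (nakayama_jac form v * inv_into UNIV v (nakayama_jac form u)) b" .
qed

lemma nakayama_jac_unit: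
  assumes u: "u \<in> algebra_auts scale"
  shows "nakayama_jac form u \<in> carrier unit_group"
proof -
  let ?v = "inv_into UNIV u"
  note v = inv_algebra_auts[OF u]
  have one: "nakayama_jac form id = 1"
    using monoid.one_closed[OF group.is_monoid[OF group_Aut]] by (intro nakayama_jac_unique) simp_all
  have r: "nakayama_jac form u * ?v (nakayama_jac form ?v) = 1"
    using nakayama_jac_comp[OF v(1) u] one v(2) by simp
  have "nakayama_jac form ?v * u (nakayama_jac form u) = 1"
    using nakayama_jac_comp[OF u v(1)] one v(3) u by (simp add: algebra_auts_def inv_inv_eq)
  then have "?v (nakayama_jac form ?v) * ?v (u (nakayama_jac form u)) = 1"
    using v(1) unfolding algebra_auts_def by (metis (mono_tags, lifting) mem_Collect_eq)
  then have "?v (nakayama_jac form ?v) * nakayama_jac form u = 1"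
    using v(2) by (metis comp_apply id_apply)
  with r show ?thesis by (auto simp: carrier_unit_group)
qed

lemma jac_cocycle: "jac_cocycle scale form \<in> cocycles (Aut scale) unit_group aut_act"
proof -
  interpret A: group "Aut scale" by (rule group_Aut)
  have "nakayama_jac form (inv\<^bsub>Aut scale\<^esub> (g \<circ> h))
      = nakayama_jac form (inv\<^bsub>Aut scale\<^esub> g) * g (nakayama_jac form (inv\<^bsub>Aut scale\<^esub> h))"
    if g: "g \<in> algebra_auts scale" and h: "h \<in> algebra_auts scale" for g h
  proof -
    have "inv\<^bsub>Aut scale\<^esub> (g \<circ> h) = inv\<^bsub>Aut scale\<^esub> h \<circ> inv\<^bsub>Aut scale\<^esub> g"
      using A.inv_mult_group[of g h] g h by simp
    moreover have "inv_into UNIV (inv_into UNIV g) = g"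
      using g by (simp add: algebra_auts_def inv_inv_eq)
    ultimately show ?thesis
      using nakayama_jac_comp[of "inv\<^bsub>Aut scale\<^esub> h" "inv\<^bsub>Aut scale\<^esub> g"] g h
      by (simp add: inv_Aut inv_algebra_auts(1))
  qed
  moreover have "g \<circ> h \<in> algebra_auts scale" if "g \<in> algebra_auts scale" "h \<in> algebra_auts scale" for g h
    using A.m_closed[of g h] that by simp
  moreover have "nakayama_jac form (inv\<^bsub>Aut scale\<^esub> g) \<in> carrier unit_group"
    if "g \<in> algebra_auts scale" for g
    using that by (intro nakayama_jac_unit) (simp add: inv_Aut inv_algebra_auts(1))
  ultimately show ?thesis
    by (simp add: cocycles_def jac_cocycle_def aut_act_def)
qed

lemma Jac_in_H1: "Jac scale form \<in> H1 (Aut scale) unit_group aut_act"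
  unfolding Jac_def H1_def H1_class_def using jac_cocycle by (rule quotientI)

end

end

theory Submission
  imports Defs
begin

text \<open>
  Write \<open>\<lambda> x = form 1 x\<close>. Triviality of the class on \<open>Inn\<close> says that some twist
  \<open>\<mu> x = \<lambda> (\<eta>\<inverse> x)\<close> satisfies \<open>\<mu> (s x) = \<mu> (x s)\<close> for all units \<open>s\<close>. Units need not span the
  algebra (over the field with two elements), but by Fitting's lemma units and idempotents do. If
  \<open>e\<close> is idempotent, then \<open>n = e x (1 - e)\<close> squares to zero, so \<open>1 - n\<close> is a unit and
  \<open>\<mu> n = \<mu> (e n) = \<mu> (n e) = 0\<close>; likewise \<open>\<mu> ((1 - e) x e) = 0\<close>, whence \<open>\<mu> (e x) = \<mu> (e x e) = \<mu> (x e)\<close>.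
  So \<open>\<mu>\<close> is symmetric.

  For a symmetric form the Jacobian cocycle takes central values and is trivial on \<open>Inn\<close>, hence
  it descends to \<open>Out\<close>. Two descents differ by the coboundary of a unit \<open>\<xi>\<close> that commutes with all
  units; applying the criterion above to \<open>x \<mapsto> \<lambda> (\<xi> x)\<close> shows that \<open>\<xi>\<close> is central.
\<close>

section \<open>Units and idempotents\<close>

text \<open>The inverse is the finite geometric sum of the powers \<open>m ^ i\<close>; both
  products telescope.\<close>

lemma unit_diff_nilpotent:
  fixes m :: "'a::{ring,monoid_mult}"
  assumes "m ^ n = 0"
  shows "1 - m \<in> carrier unit_group"
proof -
  have c: "(1 - m) * m ^ i = m ^ i - m ^ Suc i" "m ^ i * (1 - m) = m ^ i - m ^ Suc i" for i
    by (simp_all add: left_diff_distrib right_diff_distrib power_commutes)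
  have "(1 - m) * (\<Sum>i<k. m ^ i) = 1 - m ^ k \<and> (\<Sum>i<k. m ^ i) * (1 - m) = 1 - m ^ k" for k
    by (induction k) (simp_all add: distrib_left distrib_right c)
  with assms show ?thesis by (auto simp: carrier_unit_group intro!: exI[of _ "\<Sum>i<n. m ^ i"])
qed

section \<open>Fitting decomposition of an element and extension from units to all elements\<close>

context fd_algebra
begin

text \<open>The spans of the powers from \<open>a ^ n\<close> on decrease and stabilise by finite
  dimension; \<open>b\<close> arises as a polynomial in \<open>a\<close>. The exponent is positive
  so that a factor \<open>a\<close> can later be split off.\<close>

lemma power_eq_power_Suc_mult:
  fixes a :: 'a
  shows "\<exists>n b. a * b = b * a \<and> a ^ Suc n = a ^ Suc (Suc n) * b"
proof -
  obtain B0 where B0: "finite B0" "span B0 = UNIV" using finite_dim by blast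
  obtain B where B: "B \<subseteq> B0" "independent B" "B0 \<subseteq> span B"
    using maximal_independent_subset[of B0] by blast
  have fB: "finite B" using B B0 by (metis finite_subset)
  have sB: "span B = UNIV" using B B0 by (metis span_mono span_span top.extremum_unique)
  interpret fd: finite_dimensional_vector_space scale B
    by unfold_locales (use fB sB B in auto)
  define P where "P n = span ((\<lambda>i. a ^ (n + i)) ` UNIV)" for n
  have factor: "\<exists>b. a * b = b * a \<and> x = a ^ n * b" if "x \<in> P n" for n x
    using that unfolding P_def
  proof (induction rule: span_induct_alt)
    case base
    show ?case by (intro exI[of _ 0]) simp
  next
    case (step c x y)
    then obtain i b where "x = a ^ n * a ^ i" "a * b = b * a" "y = a ^ n * b"
      by (auto simp: power_add)
    then show ?case
      by (intro exI[of _ "scale c (a ^ i) + b"])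
        (simp add: distrib_left distrib_right scale_mult_left scale_mult_right power_commutes)
  qed
  have P_Suc: "P (Suc n) \<subseteq> P n" for n
    unfolding P_def by (rule span_mono) (auto intro!: image_eqI[of _ _ "Suc _"])
  \<comment> \<open>At a minimum of the dimension, \<open>P (Suc n)\<close> and
    \<open>P (Suc (Suc n))\<close> lie in \<open>P n\<close> and have its dimension.\<close>
  obtain n where "\<And>k. dim (P n) \<le> dim (P k)"
    using ex_has_least_nat[of "\<lambda>_. True" 0 "\<lambda>n. dim (P n)"] by auto
  moreover have "P (Suc (Suc n)) \<subseteq> P n" "P (Suc (Suc n)) \<subseteq> P (Suc n)" using P_Suc by blast+
  ultimately have "P (Suc (Suc n)) = P (Suc n)"
    using fd.subspace_dim_equal[of "P (Suc (Suc n))" "P (Suc n)"] fd.dim_subset[OF P_Suc[of n]]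
    by (metis P_def order.trans subspace_span)
  moreover have "a ^ Suc n \<in> P (Suc n)"
    unfolding P_def by (rule span_base) (auto intro!: image_eqI[of _ _ 0])
  ultimately show ?thesis using factor by metis
qed

text \<open>With \<open>e = a ^ n * b ^ n\<close>, the element \<open>a\<close> is invertible in the
  corner cut out by \<open>e\<close> and nilpotent in the one cut out by
  \<open>1 - e\<close>.\<close>

lemma fitting_idempotent:
  fixes a :: 'a
  obtains e where "e * e = e" "a * e + (1 - e) \<in> carrier unit_group"
    "1 - a * (1 - e) \<in> carrier unit_group"
proof -
  obtain m b where ab: "a * b = b * a" and f: "a ^ Suc m = a ^ Suc (Suc m) * b"
    using power_eq_power_Suc_mult by blast
  define n where "n = Suc m"
  have abp: "a ^ i * b ^ j = b ^ j * a ^ i" for i j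
    using power_commuting_commutes[of a "b ^ j" i] power_commuting_commutes[of b a j] ab by metis
  \<comment> \<open>The relation \<open>a ^ n = a ^ n * a * b\<close> is iterated; the case
    \<open>k = n\<close> gives \<open>a ^ n * e = a ^ n\<close>, whence \<open>e\<close> is
    idempotent.\<close>
  have "a ^ n = a ^ n * (a ^ k * b ^ k)" for k
  proof (induction k)
    case (Suc k)
    have "a ^ n * (a ^ Suc k * b ^ Suc k) = a ^ n * a * (a ^ k * b) * b ^ k"
      by (simp add: mult.assoc)
    also have "\<dots> = a ^ n * a * b * (a ^ k * b ^ k)"
      using abp[of k 1] by (simp add: mult.assoc)
    also have "a ^ n * a * b = a ^ n" using f by (simp only: n_def power_Suc2[of a "Suc m"])
    finally show ?case using Suc by (rule trans[OF _ sym, rotated])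
  qed simp
  note an = this[of n]
  define e where "e = a ^ n * b ^ n"
  \<comment> \<open>One factor \<open>a\<close> is removed from \<open>e\<close>, so
    \<open>c * e\<close> inverts \<open>a * e\<close> in the corner of \<open>e\<close>.\<close>
  define c where "c = a ^ m * b ^ n"
  have ane: "a ^ n * e = a ^ n" using an by (simp add: e_def)
  have "b ^ n * e = e * b ^ n" by (metis abp e_def mult.assoc)
  then have ee: "e * e = e" by (metis ane e_def mult.assoc)
  have ac: "a * c = e" by (simp add: c_def e_def n_def mult.assoc)
  have ca: "c * a = e"
    using abp[of 1 n] by (simp add: c_def e_def n_def mult.assoc) (metis mult.assoc power_commutes)
  have ae: "a * e = e * a" using ac ca by (metis mult.assoc)
  have ce: "c * e = e * c" using ac ca by (metis mult.assoc)
  have u: "(a * e + (1 - e)) * (c * e + (1 - e)) = 1" "(c * e + (1 - e)) * (a * e + (1 - e)) = 1"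
  proof -
    have x: "x * e * (y * e) = x * y * e" "x * e * (1 - e) = 0" "(1 - e) * (x * e) = 0"
      if "x * e = e * x" "y * e = e * y" for x y
    proof -
      show "x * e * (y * e) = x * y * e" by (metis ee mult.assoc that)
      show "x * e * (1 - e) = 0" by (simp add: right_diff_distrib mult.assoc ee)
      have "e * (x * e) = x * e" by (metis ee mult.assoc that(1))
      then show "(1 - e) * (x * e) = 0" by (simp add: left_diff_distrib)
    qed
    have y: "(1 - e) * (1 - e) = 1 - e" by (simp add: algebra_simps ee)
    show "(a * e + (1 - e)) * (c * e + (1 - e)) = 1" "(c * e + (1 - e)) * (a * e + (1 - e)) = 1"
      unfolding distrib_left distrib_right by (simp_all add: x[OF ae ce] x[OF ce ae] y ac ca ee)
  qed
  \<comment> \<open>At exponent \<open>n\<close> the right-hand side is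
    \<open>a ^ n - a ^ n * e = 0\<close>.\<close>
  have "(a * (1 - e)) ^ Suc k = a ^ Suc k * (1 - e)" for k
  proof (induction k)
    case (Suc k)
    have "(1 - e) * (a * (1 - e)) = a * (1 - e)"
      using ae ee by (simp add: algebra_simps) (metis mult.assoc)
    then have "a ^ Suc k * (1 - e) * (a * (1 - e)) = a ^ Suc k * (a * (1 - e))"
      by (simp only: mult.assoc)
    moreover have "(a * (1 - e)) ^ Suc (Suc k) = (a * (1 - e)) ^ Suc k * (a * (1 - e))"
      by (rule power_Suc2)
    ultimately show ?case using Suc by (simp only: power_Suc2[of a "Suc k"] mult.assoc)
  qed simp
  from this[of m] have "(a * (1 - e)) ^ n = 0" using ane by (simp add: n_def right_diff_distrib)
  then have "1 - a * (1 - e) \<in> carrier unit_group" by (rule unit_diff_nilpotent)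
  with ee u show thesis by (intro that[of e]) (auto simp: carrier_unit_group)
qed

text \<open>Every \<open>a\<close> is a unit plus an idempotent minus a unit, so it remains to treat
  idempotents, through their square-zero off-diagonal parts.\<close>

lemma additive_symmetric_if_symmetric_on_units:
  fixes \<mu> :: "'a \<Rightarrow> 'b::ab_group_add"
  assumes add: "\<And>x y. \<mu> (x + y) = \<mu> x + \<mu> y"
    and units: "\<And>s x. s \<in> carrier unit_group \<Longrightarrow> \<mu> (s * x) = \<mu> (x * s)"
  shows "\<mu> (a * x) = \<mu> (x * a)"
proof -
  have diff: "\<mu> (x - y) = \<mu> x - \<mu> y" for x y
    using add[of "x - y" y] by (simp add: algebra_simps)
  have sq0: "\<mu> (n * x) = \<mu> (x * n)" if "n * n = 0" for n x
  proof -
    have "n ^ Suc (Suc 0) = 0" using that by simp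
    then have "1 - n \<in> carrier unit_group" by (rule unit_diff_nilpotent)
    from units[OF this, of x] show ?thesis by (simp add: algebra_simps diff)
  qed
  have zero: "\<mu> 0 = 0" using add[of 0 0] by simp
  have idem: "\<mu> (e * x) = \<mu> (x * e)" if e: "e * e = e" for e x
  proof -
    have e': "e * (e * y) = e * y" for y using e by (simp flip: mult.assoc)
    \<comment> \<open>This element is \<open>e * x * (1 - e)\<close>: it squares to zero, is fixed
      by \<open>e\<close> on the left and killed by \<open>e\<close> on the right.\<close>
    have "\<mu> (e * x - e * x * e) = 0"
      using sq0[of "e * x - e * x * e" e] zero by (simp add: algebra_simps e e')
    moreover have "\<mu> (x * e - e * x * e) = 0"
      using sq0[of "x * e - e * x * e" e] zero by (simp add: algebra_simps e e')
    ultimately show ?thesis by (simp add: diff)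
  qed
  obtain e where e: "e * e = e" "a * e + (1 - e) \<in> carrier unit_group"
      "1 - a * (1 - e) \<in> carrier unit_group"
    by (rule fitting_idempotent)
  define p q where "p = a * e + (1 - e)" and "q = 1 - a * (1 - e)"
  have a: "a = p + e - q" by (simp add: p_def q_def algebra_simps)
  show ?thesis
    using units[OF e(2)[folded p_def], of x] units[OF e(3)[folded q_def], of x] idem[OF e(1), of x]
    by (simp add: a left_diff_distrib right_diff_distrib distrib_left distrib_right add diff)
qed

end

section \<open>Cohomology classes\<close>

lemma H1_class_eq_iff:
  assumes "group M" and "\<And>g. g \<in> carrier G \<Longrightarrow> act g \<in> hom M M"
    and "f \<in> cocycles G M act" "f' \<in> cocycles G M act"
  shows "H1_class G M act f = H1_class G M act f' \<longleftrightarrow>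
    (\<exists>\<xi>\<in>carrier M. \<forall>g\<in>carrier G. f' g = inv\<^bsub>M\<^esub> \<xi> \<otimes>\<^bsub>M\<^esub> f g \<otimes>\<^bsub>M\<^esub> act g \<xi>)"
proof -
  have "equiv (cocycles G M act) (cohomologous G M act)"
    using assms(1,2) by (rule cohomologous_equiv)
  then have "H1_class G M act f = H1_class G M act f' \<longleftrightarrow> (f, f') \<in> cohomologous G M act"
    unfolding H1_class_def using assms(3,4) by (rule eq_equiv_class_iff)
  also have "\<dots> \<longleftrightarrow> (\<exists>\<xi>\<in>carrier M. \<forall>g\<in>carrier G. f' g = inv\<^bsub>M\<^esub> \<xi> \<otimes>\<^bsub>M\<^esub> f g \<otimes>\<^bsub>M\<^esub> act g \<xi>)"
    using assms(3,4) by (simp add: cohomologous_def)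
  finally show ?thesis .
qed

lemma cocycle_one:
  assumes "group G" "group M" "\<And>x. x \<in> carrier M \<Longrightarrow> act \<one>\<^bsub>G\<^esub> x = x"
    and f: "f \<in> cocycles G M act"
  shows "f \<one>\<^bsub>G\<^esub> = \<one>\<^bsub>M\<^esub>"
proof -
  interpret G: group G by fact
  interpret M: group M by fact
  have c: "f \<one>\<^bsub>G\<^esub> \<in> carrier M" using f by (auto simp: cocycles_def)
  have "f (\<one>\<^bsub>G\<^esub> \<otimes>\<^bsub>G\<^esub> \<one>\<^bsub>G\<^esub>) = f \<one>\<^bsub>G\<^esub> \<otimes>\<^bsub>M\<^esub> act \<one>\<^bsub>G\<^esub> (f \<one>\<^bsub>G\<^esub>)"
    using f G.one_closed unfolding cocycles_def by blast
  then show ?thesis using c assms(3)[OF c] by simp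
qed

lemma carrier_central_unit_group:
  "z \<in> carrier central_unit_group \<longleftrightarrow> z \<in> carrier unit_group \<and> (\<forall>a. z * a = a * z)"
  by (simp add: central_unit_group_def)

lemma inv_central_unit_group:
  assumes "z \<in> carrier central_unit_group"
  shows "inv\<^bsub>central_unit_group\<^esub> z = inv\<^bsub>unit_group\<^esub> z"
  using group.m_inv_consistent[OF group_unit_group subgroup_central_units] assms
  by (simp add: central_unit_group_def)

context fd_algebra
begin

lemma Out_one: "\<one>\<^bsub>Out scale\<^esub> = inner_auts"
  by (simp add: Out_def FactGroup_def)

lemma inner_coset:
  assumes "u \<in> inner_auts"
  shows "inner_auts #>\<^bsub>Aut scale\<^esub> u = \<one>\<^bsub>Out scale\<^esub>"
  using assms subgroup.subset[OF subgroup_Inn]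
    group.coset_join2[OF group_Aut _ subgroup_Inn] by (auto simp: Out_one)

lemma carrier_Out: "carrier (Out scale) = (\<lambda>u. inner_auts #>\<^bsub>Aut scale\<^esub> u) ` algebra_auts scale"
  by (simp add: Out_def carrier_FactGroup)

lemma Out_cocycle_one:
  assumes "f \<in> cocycles (Out scale) central_unit_group out_act"
  shows "f \<one>\<^bsub>Out scale\<^esub> = 1"
proof -
  have id: "(id :: 'a \<Rightarrow> 'a) \<in> inner_auts" using subgroup.one_closed[OF subgroup_Inn] by simp
  have "out_act \<one>\<^bsub>Out scale\<^esub> z = z" if "z \<in> carrier central_unit_group" for z
    using out_act_coset[OF _ that, of id] inner_coset[OF id] id subgroup.subset[OF subgroup_Inn]
    by auto
  then show ?thesis
    using cocycle_one[OF group_Out group_central_unit_group _ assms] by simp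
qed

lemma H1_class_unit_group_eq_iff:
  assumes "carrier G \<subseteq> algebra_auts scale"
    and "f \<in> cocycles G unit_group aut_act" "f' \<in> cocycles G unit_group aut_act"
  shows "H1_class G unit_group aut_act f = H1_class G unit_group aut_act f' \<longleftrightarrow>
    (\<exists>\<xi>\<in>carrier unit_group. \<forall>u\<in>carrier G. f' u = inv\<^bsub>unit_group\<^esub> \<xi> * f u * u \<xi>)"
  using H1_class_eq_iff[OF group_unit_group _ assms(2,3)] aut_act_hom(1) assms(1)
  by (auto simp: aut_act_def subset_iff)

lemma restrict_cocycle:
  assumes "f \<in> cocycles (Aut scale) unit_group aut_act"
  shows "(\<lambda>u\<in>inner_auts. f u) \<in> cocycles (Inn scale) unit_group aut_act"
  using assms subgroup.subset[OF subgroup_Inn] subgroup.m_closed[OF subgroup_Inn]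
  by (auto simp: cocycles_def subset_iff)

lemma trivial_cocycle:
  "(\<lambda>u\<in>inner_auts. 1) \<in> cocycles (Inn scale) unit_group aut_act"
proof -
  have "u 1 = 1" if "u \<in> inner_auts" for u :: "'a \<Rightarrow> 'a"
    using that by (auto simp: inner_auts_iff)
  then show ?thesis
    using subgroup.m_closed[OF subgroup_Inn] monoid.one_closed[OF group.is_monoid[OF group_unit_group]]
    by (auto simp: cocycles_def aut_act_def)
qed

end


section \<open>Changing the form\<close>

context frobenius_algebra
begin

text \<open>Associativity makes the form recoverable from the functional \<open>form 1\<close>, on
  which the later identities are checked.\<close>

lemma form_one_mult: "form a b = form 1 (a * b)"
  using form_assoc[of 1 a b] by simp

lemma form_one_eqD: "(\<And>b. form 1 (a * b) = form 1 (a' * b)) \<Longrightarrow> a = a'"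
  by (rule form_eqD) (simp add: form_one_mult[of a] form_one_mult[of a'])

text \<open>Evaluating the Jacobian of the inverse automorphism at \<open>1\<close> and
  \<open>u b\<close> removes the inverse. Together with \<open>jac_cocycle_eqI\<close> this
  characterises the cocycle by the functional \<open>form 1\<close>.\<close>

lemma jac_cocycle_form:
  assumes "u \<in> algebra_auts scale"
  shows "form 1 b = form 1 (jac_cocycle scale form u * u b)"
proof -
  let ?v = "inv_into UNIV u"
  have v: "?v \<in> algebra_auts scale" and vu: "?v (u b) = b"
    using inv_algebra_auts[OF assms] by (simp_all add: fun_eq_iff)
  have "form (?v 1) (?v (u b)) = form (nakayama_jac form ?v * 1) (u b)" by (rule nakayama_jac[OF v])
  then show ?thesis
    using assms v vu by (simp add: jac_cocycle_def inv_Aut algebra_auts_def flip: form_one_mult)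
qed

lemma jac_cocycle_eqI:
  assumes u: "u \<in> algebra_auts scale" and j: "\<And>b. form 1 b = form 1 (j * u b)"
  shows "jac_cocycle scale form u = j"
proof (rule form_one_eqD)
  fix b
  have "u (inv_into UNIV u b) = b" using inv_algebra_auts(3)[OF u] by (simp add: fun_eq_iff)
  then show "form 1 (jac_cocycle scale form u * b) = form 1 (j * b)"
    using j jac_cocycle_form[OF u] by metis
qed

lemma frobenius_twist:
  assumes "w \<in> carrier unit_group"
  shows "frobenius_algebra scale (\<lambda>a b. form (w * a) b)"
proof -
  obtain t where t: "t * w = 1" "w * t = 1" using assms by (auto simp: carrier_unit_group)
  have "Vector_Spaces.linear scale scale (\<lambda>a. w * a)"
    by (simp add: linear_iff_local distrib_left scale_mult_right)
  then have l: "Vector_Spaces.linear scale (*) (\<lambda>a. form (w * a) b)" for b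
    using Vector_Spaces.linear_compose[OF _ form_linear_left[of b]] by (auto simp: comp_def)
  show ?thesis
  proof (intro frobenius_algebra.intro frobenius_algebra_axioms.intro fd_algebra_axioms)
    fix a assume "\<And>b. form (w * a) b = 0"
    then have "w * a = 0" by (rule nondegenerate_left)
    then have "t * (w * a) = 0" by simp
    then show "a = 0" using t by (simp flip: mult.assoc)
  next
    fix b assume "\<And>a. form (w * a) b = 0"
    then have "form a b = 0" for a
      using t by (metis mult.assoc mult_1_left)
    then show "b = 0" by (rule nondegenerate_right)
  next
    show "form (w * (a * b)) c = form (w * a) (b * c)" for a b c
      by (metis form_assoc mult.assoc)
  qed (rule l form_linear_right)+
qed

text \<open>Each form represents the functional of the other, and by nondegeneracy the two
  representing elements are mutually inverse.\<close>

lemma form_change: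
  assumes "frobenius_algebra scale form'"
  obtains k where "k \<in> carrier unit_group" "\<And>b. form 1 b = form' 1 (k * b)"
proof -
  interpret F: frobenius_algebra scale form' by fact
  obtain j where j: "\<And>b. form j b = form' 1 b"
    using functional_represented[OF F.form_linear_right[of 1]] by blast
  obtain k where k: "\<And>b. form' k b = form 1 b"
    using F.functional_represented[OF form_linear_right[of 1]] by blast
  have j1: "form' 1 b = form 1 (j * b)" for b using j form_one_mult by metis
  have k1: "form 1 b = form' 1 (k * b)" for b using k F.form_one_mult by metis
  have "j * k = 1" by (rule form_one_eqD) (metis j1 k1 mult.assoc mult_1_left)
  moreover have "k * j = 1" by (rule F.form_one_eqD) (metis j1 k1 mult.assoc mult_1_left)
  ultimately show thesis using that[of k] k1 by (auto simp: carrier_unit_group)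
qed

text \<open>Rewriting one functional through the other turns one characterising identity into the
  other; \<open>k\<close> is the coboundary witness for \<open>Jac_independent\<close>.\<close>

lemma jac_cocycle_change:
  assumes "frobenius_algebra scale form'" and k: "k \<in> carrier unit_group"
    and form: "\<And>b. form 1 b = form' 1 (k * b)" and u: "u \<in> algebra_auts scale"
  shows "jac_cocycle scale form u = inv\<^bsub>unit_group\<^esub> k * jac_cocycle scale form' u * u k"
proof (rule jac_cocycle_eqI[OF u])
  interpret F: frobenius_algebra scale form' by fact
  fix b
  have m: "u (k * b) = u k * u b" using u by (simp add: algebra_auts_def)
  have c: "k * (inv\<^bsub>unit_group\<^esub> k * x) = x" for x
    using unit_inv(2)[OF k] by (simp flip: mult.assoc)
  have "form 1 b = form' 1 (jac_cocycle scale form' u * u (k * b))"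
    unfolding form by (rule F.jac_cocycle_form[OF u])
  then show "form 1 b = form 1 (inv\<^bsub>unit_group\<^esub> k * jac_cocycle scale form' u * u k * u b)"
    by (simp add: form[of "_ * _"] mult.assoc c m)
qed

lemma Jac_independent:
  assumes "frobenius_algebra scale form'"
  shows "Jac scale form = Jac scale form'"
proof -
  interpret F: frobenius_algebra scale form' by fact
  obtain k where "k \<in> carrier unit_group" "\<And>b. form 1 b = form' 1 (k * b)"
    using form_change[OF assms] by blast
  then have "Jac scale form' = Jac scale form"
    unfolding Jac_def
    by (subst H1_class_unit_group_eq_iff)
      (auto simp: jac_cocycle F.jac_cocycle jac_cocycle_change[OF assms])
  then show ?thesis by simp
qed


section \<open>Triviality on inner automorphisms\<close>

text \<open>On inner automorphisms the cocycle is the coboundary of some \<open>k\<close>. Twisting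
  the form by the inverse \<open>w\<close> of \<open>k\<close> absorbs it, which gives symmetry
  against units and hence everywhere.\<close>

lemma symmetric_if_res_trivial:
  assumes "H1_res scale (Jac scale form) = H1_trivial (Inn scale) unit_group aut_act"
  shows "symmetric_algebra scale"
proof -
  have sub: "inner_auts \<subseteq> algebra_auts scale" using subgroup.subset[OF subgroup_Inn] by simp
  have "H1_class (Inn scale) unit_group aut_act (\<lambda>u\<in>inner_auts. 1) =
      H1_class (Inn scale) unit_group aut_act (\<lambda>u\<in>inner_auts. jac_cocycle scale form u)"
    using assms unfolding Jac_def H1_res_class[OF jac_cocycle] H1_trivial_def by simp
  then obtain k where k: "k \<in> carrier unit_group"
    and jac: "\<And>u. u \<in> inner_auts \<Longrightarrow> jac_cocycle scale form u = inv\<^bsub>unit_group\<^esub> k * u k"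
    using H1_class_unit_group_eq_iff[OF _ trivial_cocycle restrict_cocycle[OF jac_cocycle]] sub
    by auto
  define w where "w = inv\<^bsub>unit_group\<^esub> k"
  have w: "w \<in> carrier unit_group" "k * w = 1" using unit_inv[OF k] by (simp_all add: w_def)
  have units: "form 1 (w * (s * x)) = form 1 (w * (x * s))" if "s \<in> carrier unit_group" for s x
  proof -
    let ?t = "inv\<^bsub>unit_group\<^esub> s"
    let ?u = "\<lambda>a. s * a * ?t"
    have t: "?t * s = 1" "s * ?t = 1" using unit_inv[OF that] by auto
    have u: "?u \<in> inner_auts" using that by (auto simp: inner_auts_def)
    have c: "?t * (s * y) = y" "k * (w * y) = y" for y using t w(2) by (simp_all flip: mult.assoc)
    \<comment> \<open>The cocycle value is \<open>w * s * k * ?t\<close>; cancelling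
      \<open>?t * s\<close>, \<open>k * w\<close> and \<open>s * ?t\<close> leaves
      \<open>w * s * x\<close>.\<close>
    have "form 1 (w * (x * s)) = form 1 (jac_cocycle scale form ?u * ?u (w * (x * s)))"
      using u sub by (intro jac_cocycle_form) blast
    then show ?thesis unfolding jac[OF u] by (simp add: mult.assoc c t flip: w_def)
  qed
  have "form 1 (w * (a * x)) = form 1 (w * (x * a))" for a x
    by (rule additive_symmetric_if_symmetric_on_units[of "\<lambda>x. form 1 (w * x)"])
      (simp add: distrib_left form_simps, rule units)
  then have "form (w * a) b = form (w * b) a" for a b
    by (metis form_one_mult mult.assoc)
  then show ?thesis
    using frobenius_twist[OF w(1)] unfolding symmetric_algebra_def by blast
qed

end


section \<open>Symmetric forms\<close>

locale symmetric_frobenius_algebra = frobenius_algebra scale form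
  for scale :: "'k::field \<Rightarrow> 'a::{ring,monoid_mult} \<Rightarrow> 'a" and form :: "'a \<Rightarrow> 'a \<Rightarrow> 'k" +
  assumes form_sym: "form a b = form b a"
begin

lemma form_one_commute: "form 1 (a * b) = form 1 (b * a)"
  using form_sym[of a b] by (metis form_one_mult)

text \<open>Transporting the trace property of \<open>form 1\<close> along \<open>u\<close> shows
  that \<open>form 1 (?j * x)\<close> is a trace in \<open>x\<close> too. Comparing the two traces
  moves \<open>?j\<close> past \<open>a\<close>.\<close>

lemma jac_cocycle_central:
  assumes u: "u \<in> algebra_auts scale"
  shows "jac_cocycle scale form u \<in> carrier central_unit_group"
proof -
  let ?j = "jac_cocycle scale form u"
  have "?j * a = a * ?j" for a
  proof (rule form_one_eqD)
    fix b
    have surj: "u (inv_into UNIV u x) = x" for x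
      using inv_algebra_auts(3)[OF u] by (simp add: fun_eq_iff)
    have m: "u (x * y) = u x * u y" for x y using u by (simp add: algebra_auts_def)
    have "form 1 (?j * (u x * u y)) = form 1 (?j * (u y * u x))" for x y
      using jac_cocycle_form[OF u, of "x * y"] jac_cocycle_form[OF u, of "y * x"]
        form_one_commute[of x y] by (simp add: m)
    then have "form 1 (?j * (a * b)) = form 1 (?j * (b * a))" by (metis surj)
    also have "\<dots> = form 1 (a * (?j * b))" using form_one_commute by (metis mult.assoc)
    finally show "form 1 (?j * a * b) = form 1 (a * ?j * b)" by (simp add: mult.assoc)
  qed
  moreover have "?j \<in> carrier unit_group" using jac_cocycle u by (auto simp: cocycles_def)
  ultimately show ?thesis by (simp add: carrier_central_unit_group)
qed

text \<open>A trace is invariant under conjugation, so \<open>1\<close> satisfies the characterising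
  identity.\<close>

lemma jac_cocycle_inner:
  assumes "u \<in> inner_auts"
  shows "jac_cocycle scale form u = 1"
proof (rule jac_cocycle_eqI)
  show "u \<in> algebra_auts scale" using assms subgroup.subset[OF subgroup_Inn] by auto
  fix b
  obtain s t where st: "t * s = 1" "u = (\<lambda>a. s * a * t)" using assms by (auto simp: inner_auts_iff)
  have "form 1 (s * (b * t)) = form 1 (b * t * s)" by (rule form_one_commute)
  then show "form 1 b = form 1 (1 * u b)" using st by (simp add: mult.assoc)
qed

text \<open>For \<open>v = h \<circ> u\<close> with \<open>h\<close> inner, the cocycle rule leaves
  the conjugate of a central value, which is that value.\<close>

lemma jac_cocycle_coset:
  assumes u: "u \<in> algebra_auts scale" and v: "v \<in> inner_auts #>\<^bsub>Aut scale\<^esub> u"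
  shows "jac_cocycle scale form v = jac_cocycle scale form u"
proof -
  obtain h where h: "h \<in> inner_auts" "v = h \<circ> u" using v by (auto simp: r_coset_def)
  obtain s t where st: "s * t = 1" "h = (\<lambda>a. s * a * t)" using h by (auto simp: inner_auts_iff)
  have "h \<in> algebra_auts scale" using h subgroup.subset[OF subgroup_Inn] by auto
  then have "jac_cocycle scale form v
      = jac_cocycle scale form h * h (jac_cocycle scale form u)"
    using jac_cocycle u by (auto simp: cocycles_def h aut_act_def)
  also have "\<dots> = s * jac_cocycle scale form u * t" using jac_cocycle_inner[OF h(1)] by (simp add: st)
  also have "\<dots> = jac_cocycle scale form u * (s * t)"
    using jac_cocycle_central[OF u] by (simp add: carrier_central_unit_group mult.assoc)
  finally show ?thesis by (simp add: st)
qed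

section \<open>Descent to \<open>Out\<close> and its uniqueness\<close>

definition out_jac :: "('a \<Rightarrow> 'a) set \<Rightarrow> 'a"
  where "out_jac = (\<lambda>C\<in>carrier (Out scale). jac_cocycle scale form (SOME v. v \<in> C))"

lemma out_jac_coset:
  assumes u: "u \<in> algebra_auts scale"
  shows "out_jac (inner_auts #>\<^bsub>Aut scale\<^esub> u) = jac_cocycle scale form u"
proof -
  let ?C = "inner_auts #>\<^bsub>Aut scale\<^esub> u"
  have "u \<in> ?C" using group.rcos_self[OF group_Aut _ subgroup_Inn] u by simp
  then have "(SOME v. v \<in> ?C) \<in> ?C" by (rule someI[of "\<lambda>v. v \<in> ?C"])
  then show ?thesis using u by (simp add: out_jac_def carrier_Out jac_cocycle_coset)
qed

text \<open>The projection to cosets is a homomorphism and \<open>out_act\<close> on central units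
  is evaluation of a representative, so the cocycle rule descends.\<close>

lemma out_jac_cocycle: "out_jac \<in> cocycles (Out scale) central_unit_group out_act"
proof -
  let ?p = "\<lambda>u. inner_auts #>\<^bsub>Aut scale\<^esub> u"
  have hom: "?p u \<otimes>\<^bsub>Out scale\<^esub> ?p v = ?p (u \<circ> v)"
    if "u \<in> algebra_auts scale" "v \<in> algebra_auts scale" for u v
    using normal.r_coset_hom_Mod[OF normal_Inn] that by (auto simp: Out_def hom_def)
  have comp: "u \<circ> v \<in> algebra_auts scale"
    if "u \<in> algebra_auts scale" "v \<in> algebra_auts scale" for u v
    using monoid.m_closed[OF group.is_monoid[OF group_Aut]] that by simp
  have "jac_cocycle scale form (u \<circ> v) = jac_cocycle scale form u * u (jac_cocycle scale form v)"
    if "u \<in> algebra_auts scale" "v \<in> algebra_auts scale" for u v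
    using jac_cocycle that by (auto simp: cocycles_def aut_act_def)
  then have "out_jac (?p u \<otimes>\<^bsub>Out scale\<^esub> ?p v) = out_jac (?p u) * out_act (?p u) (out_jac (?p v))"
    if "u \<in> algebra_auts scale" "v \<in> algebra_auts scale" for u v
    using that comp by (simp add: hom out_jac_coset out_act_coset jac_cocycle_central)
  moreover have "out_jac \<in> extensional (carrier (Out scale))" by (simp add: out_jac_def)
  ultimately show ?thesis
    by (auto simp: cocycles_def carrier_Out PiE_def out_jac_coset jac_cocycle_central)
qed

lemma H1_inf_out_jac:
  "H1_inf scale (H1_class (Out scale) central_unit_group out_act out_jac) = Jac scale form"
proof -
  have "(\<lambda>u\<in>carrier (Aut scale). out_jac (inner_auts #>\<^bsub>Aut scale\<^esub> u)) = jac_cocycle scale form"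
    by (auto simp: fun_eq_iff out_jac_coset) (simp add: jac_cocycle_def)
  then show ?thesis unfolding H1_inf_class(2)[OF out_jac_cocycle] Jac_def by simp
qed

text \<open>The functional \<open>form 1 (x * y)\<close> in \<open>y\<close> is symmetric against
  units, hence symmetric; combined with the trace property of \<open>form 1\<close>, this moves
  \<open>x\<close> past \<open>a\<close>.\<close>

lemma central_if_commutes_with_units:
  fixes x a :: 'a
  assumes "\<And>s. s \<in> carrier unit_group \<Longrightarrow> x * s = s * x"
  shows "x * a = a * x"
proof (rule form_one_eqD)
  fix b
  have units: "form 1 (x * (s * y)) = form 1 (x * (y * s))" if "s \<in> carrier unit_group" for s y
    using assms[OF that] form_one_commute[of s "x * y"] by (metis mult.assoc)
  have "form 1 (x * (a * b)) = form 1 (x * (b * a))"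
    by (rule additive_symmetric_if_symmetric_on_units[of "\<lambda>y. form 1 (x * y)"])
      (simp add: distrib_left form_simps, rule units)
  also have "\<dots> = form 1 (a * (x * b))" using form_one_commute[of "x * b" a] by (simp add: mult.assoc)
  finally show "form 1 (x * a * b) = form 1 (a * x * b)" by (simp add: mult.assoc)
qed

text \<open>The coboundary witness \<open>\<xi>\<close> is a priori only a unit of the algebra;
  evaluation at inner automorphisms forces it to be central, so it already works over
  \<open>Out\<close>.\<close>

lemma H1_inf_inj:
  assumes f: "f \<in> cocycles (Out scale) central_unit_group out_act"
    and f': "f' \<in> cocycles (Out scale) central_unit_group out_act"
    and eq: "H1_inf scale (H1_class (Out scale) central_unit_group out_act f)
      = H1_inf scale (H1_class (Out scale) central_unit_group out_act f')"
  shows "H1_class (Out scale) central_unit_group out_act f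
    = H1_class (Out scale) central_unit_group out_act f'"
proof -
  let ?p = "\<lambda>u. inner_auts #>\<^bsub>Aut scale\<^esub> u"
  obtain \<xi> where xi: "\<xi> \<in> carrier unit_group"
    and e: "\<And>u. u \<in> algebra_auts scale \<Longrightarrow> f' (?p u) = inv\<^bsub>unit_group\<^esub> \<xi> * f (?p u) * u \<xi>"
    using eq H1_class_unit_group_eq_iff[OF _ H1_inf_class(1)[OF f] H1_inf_class(1)[OF f']]
    unfolding H1_inf_class(2)[OF f] H1_inf_class(2)[OF f'] by auto
  have "\<xi> * s = s * \<xi>" if s: "s \<in> carrier unit_group" for s
  proof -
    let ?t = "inv\<^bsub>unit_group\<^esub> s"
    have u: "(\<lambda>a. s * a * ?t) \<in> inner_auts" using s by (auto simp: inner_auts_def)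
    then have "(\<lambda>a. s * a * ?t) \<in> algebra_auts scale" using subgroup.subset[OF subgroup_Inn] by auto
    \<comment> \<open>Inner automorphisms project to the identity of \<open>Out\<close>, where both
      \<open>f\<close> and \<open>f'\<close> take the value \<open>1\<close>.\<close>
    from e[OF this] have "inv\<^bsub>unit_group\<^esub> \<xi> * (s * \<xi> * ?t) = 1"
      by (simp add: inner_coset[OF u] Out_cocycle_one f f')
    then have "s * \<xi> * ?t = \<xi>" using unit_inv(2)[OF xi] by (metis mult.assoc mult_1_left mult_1_right)
    then show ?thesis using unit_inv(1)[OF s] by (metis mult.assoc mult_1_right)
  qed
  then have "\<xi> * a = a * \<xi>" for a by (rule central_if_commutes_with_units)
  then have "\<xi> \<in> carrier central_unit_group"
    using xi by (simp add: carrier_central_unit_group)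
  then show ?thesis
    by (subst H1_class_eq_iff[OF group_central_unit_group out_act_hom f f'])
      (auto simp: carrier_Out e out_act_coset inv_central_unit_group intro!: bexI[of _ \<xi>])
qed

lemma res_Jac_trivial:
  "H1_res scale (Jac scale form) = H1_trivial (Inn scale) unit_group aut_act"
proof -
  have "(\<lambda>u\<in>inner_auts. jac_cocycle scale form u) = (\<lambda>u\<in>inner_auts. 1)"
    using jac_cocycle_inner by auto
  then show ?thesis unfolding Jac_def H1_res_class[OF jac_cocycle] H1_trivial_def by simp
qed

lemma ex1_inf_eq_Jac:
  "\<exists>!c. c \<in> H1 (Out scale) central_unit_group out_act \<and> H1_inf scale c = Jac scale form"
proof (rule ex1I)
  show "H1_class (Out scale) central_unit_group out_act out_jac \<in> H1 (Out scale) central_unit_group out_act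
      \<and> H1_inf scale (H1_class (Out scale) central_unit_group out_act out_jac) = Jac scale form"
    using H1_inf_out_jac out_jac_cocycle by (auto simp: H1_def H1_class_def intro: quotientI)
  fix c assume c: "c \<in> H1 (Out scale) central_unit_group out_act \<and> H1_inf scale c = Jac scale form"
  then obtain f where "f \<in> cocycles (Out scale) central_unit_group out_act"
      "c = H1_class (Out scale) central_unit_group out_act f"
    by (auto simp: H1_def H1_class_def elim: quotientE)
  then show "c = H1_class (Out scale) central_unit_group out_act out_jac"
    using c H1_inf_inj[OF _ out_jac_cocycle] H1_inf_out_jac by simp
qed

end

theorem proposition5:
  fixes scale :: "'k::field \<Rightarrow> 'a::{ring,monoid_mult} \<Rightarrow> 'a"
    and form :: "'a \<Rightarrow> 'a \<Rightarrow> 'k"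
  assumes "frobenius_algebra scale form"
  shows "(symmetric_algebra scale \<longleftrightarrow>
            H1_res scale (Jac scale form) = H1_trivial (Inn scale) unit_group aut_act) \<and>
         (symmetric_algebra scale \<longrightarrow>
            (\<exists>!c. c \<in> H1 (Out scale) central_unit_group out_act \<and>
                  H1_inf scale c = Jac scale form))"
proof -
  interpret frobenius_algebra scale form by fact
  have "H1_res scale (Jac scale form) = H1_trivial (Inn scale) unit_group aut_act \<and>
      (\<exists>!c. c \<in> H1 (Out scale) central_unit_group out_act \<and> H1_inf scale c = Jac scale form)"
    if sym: "symmetric_algebra scale"
  proof -
    obtain form' where F: "frobenius_algebra scale form'" "\<And>a b. form' a b = form' b a"
      using sym by (auto simp: symmetric_algebra_def)
    interpret S: symmetric_frobenius_algebra scale form'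
      using F by (simp add: symmetric_frobenius_algebra_def symmetric_frobenius_algebra_axioms_def)
    \<comment> \<open>The class is the same for both forms, so it may be computed with the symmetric
      one.\<close>
    show ?thesis
      unfolding Jac_independent[OF F(1)] using S.res_Jac_trivial S.ex1_inf_eq_Jac by blast
  qed
  then show ?thesis using symmetric_if_res_trivial by blast
qed

end
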